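(* Let $r \ge 1$ be an integer and $d = 2^r$ (so $r = \lceil \log_2(d) \rceil$). Let $C^r \in \mathbb{Z}^{d \times r}$ be the integer matrix defined in the context, with the convention $C^r_0 = C^r_1$ and $C^r_{d+1} = C^r_d$. Then each of the following two systems is an ideal formulation for the SOS2 constraint with $d$ segments, $\lambda \in \bigcup_{i=1}^d P(\{i,i+1\})$: (a) all $(\lambda,y)$ such that $$\sum_{v=1}^{d+1} C^r_{v-1,k}\lambda_v \leq y_k \leq \sum_{v=1}^{d+1} C^r_{v,k}\lambda_v \quad \forall k \in \{1,\ldots,r\}, \qquad (\lambda,y) \in \Delta^{d+1} \times \mathbb{Z}^r;$$ (b) all $(\lambda,y)$ such that $$\sum_{v=1}^{d+1} C^r_{v-1,k}\lambda_v \leq y_k + \sum_{\ell=k+1}^r 2^{\ell-k-1} y_{\ell} \leq \sum_{v=1}^{d+1} C^r_{v,k}\lambda_v \quad \forall k \in \{1,\ldots,r\}, \qquad (\lambda,y) \in \Delta^{d+1} \times \{0,1\}^r.$$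
   Context: $\Delta^{d+1} = \{\lambda \in \mathbb{R}^{d+1} : \lambda \ge 0, \sum_{v=1}^{d+1}\lambda_v = 1\}$. For $T \subseteq \{1,\ldots,d+1\}$, $P(T) = \{\lambda \in \Delta^{d+1} : \lambda_v = 0 \text{ for all } v \notin T\}$. The binary reflected Gray code matrices $K^r \in \{0,1\}^{2^r \times r}$ are defined recursively by $K^1 = (0,1)^T$ and $$K^{r+1} = \begin{pmatrix} K^r & \mathbf{0} \\ \operatorname{rev}(K^r) & \mathbf{1} \end{pmatrix},$$ where $\operatorname{rev}$ reverses the order of the rows and $\mathbf{0},\mathbf{1} \in \mathbb{R}^{2^r}$ are the all-zeros and all-ones column vectors. With $d = 2^r$, the matrix $C^r \in \mathbb{Z}^{d\times r}$ is defined by $C^r_{i,k} = \sum_{j=2}^{i} |K^r_{j,k} - K^r_{j-1,k}|$ for $1 \le i \le d$, $1 \le k \le r$. $C^r_i$ denotes the $i$-th row of $C^r$. The LP relaxation of a system is the polyhedron obtained by dropping integrality: $y \in \mathbb{Z}^r$ is replaced by $y \in \mathbb{R}^r$ in (a), and $y \in \{0,1\}^r$ is replaced by $y \in [0,1]^r$ in (b). A system in $(\lambda,y)$ is a formulation for a set $U$ if $\lambda \in U$ if and only if there is $y$ such that $(\lambda,y)$ satisfies the system (including integrality). It is ideal if moreover every extreme point of its LP relaxation has integral $y$, and the projection of the LP relaxation onto the $\lambda$-space equals the convex hull $\operatorname{Conv}(U)$. *)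

theory Defs
  imports "HOL-Analysis.Analysis" "HOL-Analysis.Finite_Function_Topology"
begin

text \<open>
  The dimension \<open>d + 1\<close> depends on \<open>r\<close>, so \<open>\<real>\<^sup>n\<close> is rendered as the space of finitely supported
  functions on \<^typ>\<open>nat\<close> with support in \<open>{1..n}\<close>, coordinate \<open>v\<close> of \<open>x\<close> being \<open>coord x v\<close>. This type is a
  \<open>real_vector\<close>, so \<open>convex hull\<close> and \<open>extreme_point_of\<close> are the library notions; neither depends
  on the ambient space.
\<close>

type_synonym rvec = "(nat, real) poly_mapping"

abbreviation coord :: "rvec \<Rightarrow> nat \<Rightarrow> real" where
  "coord \<equiv> Poly_Mapping.lookup"

definition real_vecs :: "nat \<Rightarrow> rvec set" where
  "real_vecs n = {x. Poly_Mapping.keys x \<subseteq> {1..n}}"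

definition int_vecs :: "nat \<Rightarrow> rvec set" where
  "int_vecs n = {x \<in> real_vecs n. \<forall>k\<in>{1..n}. coord x k \<in> \<int>}"

definition binary_vecs :: "nat \<Rightarrow> rvec set" where
  "binary_vecs n = {x \<in> real_vecs n. \<forall>k\<in>{1..n}. coord x k \<in> {0, 1}}"

definition unit_box_vecs :: "nat \<Rightarrow> rvec set" where
  "unit_box_vecs n = {x \<in> real_vecs n. \<forall>k\<in>{1..n}. coord x k \<in> {0..1}}"

text \<open>Here \<open>n\<close> is the number of coordinates, not the dimension of the simplex.\<close>

definition unit_simplex :: "nat \<Rightarrow> rvec set" where
  "unit_simplex n =
     {x \<in> real_vecs n. (\<forall>v\<in>{1..n}. 0 \<le> coord x v) \<and> (\<Sum>v=1..n. coord x v) = 1}"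

definition simplex_face :: "nat \<Rightarrow> nat set \<Rightarrow> rvec set" where
  "simplex_face n T = {x \<in> unit_simplex n. \<forall>v\<in>{1..n} - T. coord x v = 0}"

definition sos2 :: "nat \<Rightarrow> rvec set" where
  "sos2 d = (\<Union>i\<in>{1..d}. simplex_face (d + 1) {i, i + 1})"

text \<open>
  \<open>gray r i k\<close> is the entry of \<open>K\<^sup>r\<close> in row \<open>i \<in> {1..2 ^ r}\<close> and column \<open>k \<in> {1..r}\<close>; values elsewhere
  (and for \<open>r = 0\<close>) are irrelevant. Row \<open>i > 2 ^ s\<close> of \<open>K\<^sup>s\<^sup>+\<^sup>1\<close> is row \<open>i - 2 ^ s\<close> of the reversed block,
  which is row \<open>2 ^ s + 1 - (i - 2 ^ s)\<close> of \<open>K\<^sup>s\<close>.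
\<close>

fun gray :: "nat \<Rightarrow> nat \<Rightarrow> nat \<Rightarrow> int" where
  "gray 0 i k = 0"
| "gray (Suc 0) i k = (if i = 1 then 0 else 1)"
| "gray (Suc (Suc r)) i k =
     (let s = Suc r in
      if i \<le> 2 ^ s
      then (if k \<le> s then gray s i k else 0)
      else (if k \<le> s then gray s (2 ^ s + 1 - (i - 2 ^ s)) k else 1))"

definition zigzag :: "nat \<Rightarrow> nat \<Rightarrow> nat \<Rightarrow> int" where
  "zigzag r i k = (\<Sum>j=2..i. \<bar>gray r j k - gray r (j - 1) k\<bar>)"

text \<open>The rows \<open>0\<close> and \<open>d + 1\<close> are added as copies of the rows \<open>1\<close> and \<open>d\<close>, where \<open>d = 2 ^ r\<close>.\<close>

definition zigzag_ext :: "nat \<Rightarrow> nat \<Rightarrow> nat \<Rightarrow> int" where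
  "zigzag_ext r i k =
     (if i = 0 then zigzag r 1 k
      else if i = 2 ^ r + 1 then zigzag r (2 ^ r) k
      else zigzag r i k)"

text \<open>
  The systems take the domain \<open>Y\<close> of \<open>y\<close> as a parameter, so that the same linear inequalities give
  both the mixed-integer system and its LP relaxation.
\<close>

definition zigzag_integer_system :: "nat \<Rightarrow> rvec set \<Rightarrow> (rvec \<times> rvec) set" where
  "zigzag_integer_system r Y =
     {(x, y). x \<in> unit_simplex (2 ^ r + 1) \<and> y \<in> Y \<and>
        (\<forall>k\<in>{1..r}.
           (\<Sum>v=1..2 ^ r + 1. of_int (zigzag_ext r (v - 1) k) * coord x v) \<le> coord y k \<and>
           coord y k \<le> (\<Sum>v=1..2 ^ r + 1. of_int (zigzag_ext r v k) * coord x v))}"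

definition zigzag_binary_system :: "nat \<Rightarrow> rvec set \<Rightarrow> (rvec \<times> rvec) set" where
  "zigzag_binary_system r Y =
     {(x, y). x \<in> unit_simplex (2 ^ r + 1) \<and> y \<in> Y \<and>
        (\<forall>k\<in>{1..r}.
           (\<Sum>v=1..2 ^ r + 1. of_int (zigzag_ext r (v - 1) k) * coord x v)
             \<le> coord y k + (\<Sum>l=k+1..r. 2 ^ (l - k - 1) * coord y l) \<and>
           coord y k + (\<Sum>l=k+1..r. 2 ^ (l - k - 1) * coord y l)
             \<le> (\<Sum>v=1..2 ^ r + 1. of_int (zigzag_ext r v k) * coord x v))}"

definition is_formulation :: "(rvec \<times> rvec) set \<Rightarrow> rvec set \<Rightarrow> bool" where
  "is_formulation S U \<longleftrightarrow> (\<forall>x. x \<in> U \<longleftrightarrow> (\<exists>y. (x, y) \<in> S))"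

text \<open>\<open>S\<close> is the mixed-integer system, \<open>R\<close> its LP relaxation, \<open>r\<close> the number of \<open>y\<close>-variables.\<close>

definition ideal_formulation ::
    "nat \<Rightarrow> (rvec \<times> rvec) set \<Rightarrow> (rvec \<times> rvec) set \<Rightarrow> rvec set \<Rightarrow> bool" where
  "ideal_formulation r S R U \<longleftrightarrow>
     is_formulation S U \<and>
     (\<forall>x y. (x, y) extreme_point_of R \<longrightarrow> y \<in> int_vecs r) \<and>
     fst ` R = convex hull U"

end

theory Submission
  imports Defs
begin

text \<open>
  Write \<open>C\<^sub>j\<close> for row \<open>j + 1\<close> of the zigzag matrix, \<open>j < d = 2 ^ r\<close>. In column \<open>k\<close> the reflected Gray
  code flips exactly at the odd multiples of \<open>2 ^ (k - 1)\<close>, so \<open>C\<^sub>j\<close> has the closed form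
  \<open>\<lfloor>j / 2 ^ k + 1 / 2\<rfloor>\<close> (\<open>zigzag_eq_flips\<close>). Consecutive rows of \<open>C\<close> differ in exactly one column,
  because every positive integer is an odd multiple of exactly one power of two
  (\<open>flips_jump_unique\<close>).

  This makes the LP relaxation of the first system easy to describe. At a unit vector \<open>\<lambda> = e\<^sub>v\<close> the
  inequalities confine \<open>y\<close> to the box spanned by two consecutive rows of \<open>C\<close>, and this box is just a
  segment, or a point at the two end vertices. For general \<open>\<lambda>\<close>, each \<open>y\<^sub>k\<close> lies at some fraction
  \<open>t\<^sub>k\<close> of the way between its bounds; moving the same fractions along the segments over the \<open>e\<^sub>v\<close> writes \<open>(\<lambda>, y)\<close> as a convex combination
  of points over unit vectors. Hence the relaxation is the convex hull of the points
  \<open>(e\<^sub>j\<^sub>+\<^sub>1, C\<^sub>j)\<close> and \<open>(e\<^sub>j\<^sub>+\<^sub>2, C\<^sub>j)\<close> (\<open>system_eq_hull\<close>), so its extreme points are integral and its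
  projection is the whole simplex, which is the convex hull of the SOS2 set.

  The second system arises from the first by the unimodular substitution
  \<open>y\<^sub>k \<mapsto> y\<^sub>k + \<Sum>\<^sub>l\<^sub>>\<^sub>k 2 ^ (l - k - 1) y\<^sub>l\<close>, which sends the binary digits of \<open>j\<close> to \<open>C\<^sub>j\<close>. Both systems are
  therefore instances of one locale. The substitution also shows that integer points select a
  segment: its inverse maps the hull of the \<open>C\<^sub>j\<close> onto the unit cube, an integer point of the cube is
  one of its vertices, and a vertex is a convex combination of codes only if all of them agree with
  it. So an integral \<open>y\<close> forces all the weight onto the two points with one code \<open>C\<^sub>j\<close>
  (\<open>support_of_integer_point\<close>), that is, \<open>\<lambda>\<close> onto two consecutive coordinates.
\<close>

section \<open>Closed form of the zigzag codes\<close>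

text \<open>
  The number of odd multiples of \<open>2 ^ (k - 1)\<close> in \<open>{1..m}\<close>. This is how often column \<open>k\<close> of the Gray
  code changes during the first \<open>m\<close> steps; columns count from 1, steps from 0.
\<close>

definition flips :: "nat \<Rightarrow> nat \<Rightarrow> nat" where
  "flips k m = (m + 2 ^ (k - 1)) div 2 ^ k"

definition digit :: "nat \<Rightarrow> nat \<Rightarrow> nat" where
  "digit k m = m div 2 ^ (k - 1) mod 2"

text \<open>
  The two quotients round \<open>(m + 1 / 2) / (2 * h)\<close> and its mirror image \<open>q - (m + 1 / 2) / (2 * h)\<close> to the
  nearest integer. As \<open>m + 1 / 2\<close> is never a multiple of \<open>h\<close>, no tie occurs that would break the
  symmetry.
\<close>

lemma div_add_div_reflected:
  fixes m m' h q :: nat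
  assumes "h > 0" and sum: "m + m' + 1 = 2 * h * q"
  shows "(m + h) div (2 * h) + (m' + h) div (2 * h) = q"
proof -
  define a u where "a = (m + h) div (2 * h)" and "u = (m + h) mod (2 * h)"
  have mh: "m + h = 2 * h * a + u" and u: "u < 2 * h"
    using \<open>h > 0\<close> by (simp_all add: a_def u_def)
  have "2 * h * a < 2 * h * (q + 1)"
    using mh sum by (simp add: algebra_simps)
  then obtain c where c: "q = a + c"
    by (metis Suc_eq_plus1 less_Suc_eq_le mult_less_cancel1 le_Suc_ex)
  have "m' + h = 2 * h * c + (2 * h - 1 - u)"
    using mh sum u by (simp add: c algebra_simps)
  then have "(m' + h) div (2 * h) = c"
    using \<open>h > 0\<close> by simp
  then show ?thesis
    by (simp add: c a_def)
qed

lemma flips_0: "1 \<le> k \<Longrightarrow> flips k 0 = 0"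
  by (simp add: flips_def)

lemma flips_mono: "m \<le> n \<Longrightarrow> flips k m \<le> flips k n"
  by (simp add: flips_def div_le_mono)

lemma flips_Suc:
  assumes "1 \<le> k"
  shows "flips k (Suc m) = flips k m + (if 2 ^ k dvd Suc m + 2 ^ (k - 1) then 1 else 0)"
  using assms by (simp add: flips_def div_Suc dvd_eq_mod_eq_0)

lemma flips_reflected:
  assumes "1 \<le> k" "k \<le> s" "m < 2 ^ Suc s"
  shows "flips k m + flips k (2 ^ Suc s - 1 - m) = 2 ^ (Suc s - k)"
proof -
  have k: "(2::nat) ^ k = 2 * 2 ^ (k - 1)"
    using assms by (simp flip: power_Suc)
  have "(2::nat) ^ Suc s = 2 ^ k * 2 ^ (Suc s - k)"
    using assms by (simp flip: power_add del: power_Suc)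
  then show ?thesis
    using div_add_div_reflected[of "2 ^ (k - 1)" m "2 ^ Suc s - 1 - m" "2 ^ (Suc s - k)"] assms
    by (simp add: flips_def k del: power_Suc)
qed

text \<open>
  Reversing the rows does not change the formula: by \<open>flips_reflected\<close> the counts at \<open>m\<close> and at its
  mirror image add up to \<open>2 ^ (s + 1 - k)\<close>, which is even for the columns \<open>k \<le> s\<close> that are reflected.
\<close>

lemma gray_eq_flips_mod_2:
  assumes "1 \<le> k" "k \<le> r" "m < 2 ^ r"
  shows "gray r (Suc m) k = int (flips k m mod 2)"
  using assms
proof (induction r arbitrary: m)
  case 0
  then show ?case by simp
next
  case (Suc s)
  show ?case
  proof (cases "s = 0")
    case True
    with Suc.prems have "k = 1" "m = 0 \<or> m = 1" by auto
    then show ?thesis by (auto simp: True flips_def)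
  next
    case False
    then obtain s' where s: "s = Suc s'" by (cases s) auto
    show ?thesis
    proof (cases "k \<le> s")
      case k: True
      show ?thesis
      proof (cases "m < 2 ^ s")
        case True
        then show ?thesis
          using k Suc.IH[of m] Suc.prems by (simp add: s)
      next
        case m: False
        define m' where "m' = 2 ^ Suc s - 1 - m"
        have m': "m' < 2 ^ s" "2 ^ s + 1 - (Suc m - 2 ^ s) = Suc m'"
          using m Suc.prems by (auto simp: m'_def)
        have "even (flips k m + flips k m')"
          using flips_reflected[of k s m] Suc.prems k by (simp add: m'_def del: power_Suc)
        then have "flips k m mod 2 = flips k m' mod 2"
          by presburger
        moreover have "gray (Suc s) (Suc m) k = gray s (Suc m') k"
          using k m m'(2) unfolding s by (simp add: Let_def)
        ultimately show ?thesis
          using Suc.IH[of m'] k Suc.prems m'(1) by simp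
      qed
    next
      case False
      then have k: "k = Suc s" using Suc.prems by simp
      have "flips k m = (if m < 2 ^ s then 0 else 1)"
        using Suc.prems by (auto simp: k flips_def intro!: div_nat_eqI)
      then show ?thesis
        unfolding k s by (auto simp: Let_def)
    qed
  qed
qed

lemma zigzag_eq_flips:
  assumes "1 \<le> k" "k \<le> r" "m < 2 ^ r"
  shows "zigzag r (Suc m) k = int (flips k m)"
  using assms(3)
proof (induction m)
  case 0
  then show ?case using assms by (simp add: zigzag_def flips_0)
next
  case (Suc m)
  have "zigzag r (Suc (Suc m)) k
      = zigzag r (Suc m) k + \<bar>gray r (Suc (Suc m)) k - gray r (Suc m) k\<bar>"
    by (simp add: zigzag_def)
  also have "\<dots> = int (flips k m) + \<bar>int (flips k (Suc m) mod 2) - int (flips k m mod 2)\<bar>"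
    using Suc assms by (simp add: gray_eq_flips_mod_2)
  also have "\<dots> = int (flips k (Suc m))"
    using assms by (auto simp: flips_Suc mod_Suc split: if_splits)
  finally show ?case .
qed

text \<open>
  The clamped index absorbs both boundary conventions: truncated subtraction gives code 0 for row 0,
  and the minimum gives code \<open>2 ^ r - 1\<close> for row \<open>2 ^ r + 1\<close>.
\<close>

lemma zigzag_ext_eq_flips:
  assumes "1 \<le> k" "k \<le> r" "v \<le> 2 ^ r + 1"
  shows "zigzag_ext r v k = int (flips k (min (v - 1) (2 ^ r - 1)))"
proof -
  consider "v = 0" | "v = 2 ^ r + 1" | m where "v = Suc m" "m < 2 ^ r"
    using assms(3) by (cases v) (auto simp: le_Suc_eq)
  then show ?thesis
    using assms zigzag_eq_flips[OF assms(1,2), of 0] zigzag_eq_flips[OF assms(1,2), of "2 ^ r - 1"]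
    by cases (auto simp: zigzag_ext_def zigzag_eq_flips min_absorb1 min_absorb2)
qed

text \<open>
  A jump at column \<open>k\<close> means that \<open>m + 1\<close> is an odd multiple of \<open>2 ^ (k - 1)\<close>, which determines \<open>k\<close>.
\<close>

lemma flips_jump_unique:
  assumes k: "1 \<le> k" "flips k (Suc m) \<noteq> flips k m"
    and l: "1 \<le> l" "flips l (Suc m) \<noteq> flips l m"
  shows "k = l"
proof -
  have no_lt: "\<not> k < l" if "1 \<le> k" "2 ^ k dvd Suc m + 2 ^ (k - 1)" "2 ^ l dvd Suc m + 2 ^ (l - 1)"
    for k l
  proof
    assume "k < l"
    then have "2 ^ k dvd (2::nat) ^ l" "2 ^ k dvd (2::nat) ^ (l - 1)"
      by (auto intro!: le_imp_power_dvd)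
    with that have "2 ^ k dvd Suc m"
      by (metis dvd_add_left_iff dvd_trans)
    with that have "(2::nat) ^ k dvd 2 ^ (k - 1)"
      using dvd_add_right_iff by blast
    then show False
      using \<open>1 \<le> k\<close> by (auto dest: power_dvd_imp_le)
  qed
  show ?thesis
    using no_lt[of k l] no_lt[of l k] assms by (auto simp: flips_Suc split: if_splits)
qed

section \<open>Zigzag codes and binary digits\<close>

text \<open>
  Rounding \<open>m / 2 ^ k\<close> to the nearest integer is rounding down, plus one if the next binary digit is 1.
  Together with the next two sums this expresses the zigzag code linearly through the digits,
  and the digits linearly through the zigzag code.
\<close>

lemma flips_eq_digit:
  assumes "1 \<le> k"
  shows "flips k m = digit k m + m div 2 ^ k"
proof -
  define n where "n = m div 2 ^ (k - 1)"
  have k: "(2::nat) ^ k = 2 ^ (k - 1) * 2"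
    using assms by (simp flip: power_Suc2)
  have "flips k m = (n + 1) div 2" "m div 2 ^ k = n div 2"
    unfolding flips_def n_def k by (simp_all only: div_mult2_eq div_add_self2 power_not_zero zero_neq_numeral) simp_all
  moreover have "digit k m = n mod 2"
    by (simp add: digit_def n_def)
  moreover have "(n + 1) div 2 = n mod 2 + n div 2"
    by presburger
  ultimately show ?thesis by simp
qed

lemma sum_flips_above:
  assumes "k \<le> r" "m < 2 ^ r"
  shows "(\<Sum>l=k+1..r. flips l m) = m div 2 ^ k"
  using assms(1)
proof (induction rule: inc_induct)
  case base
  then show ?case using assms by simp
next
  case (step k)
  have "(\<Sum>l=k+1..r. flips l m) = flips (k+1) m + m div 2 ^ (k + 1)"
    using step by (simp add: sum.atLeast_Suc_atMost)
  also have "\<dots> = digit (k + 1) m + 2 * (m div 2 ^ (k + 1))"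
    by (simp add: flips_eq_digit)
  also have "\<dots> = m div 2 ^ k"
    by (simp add: digit_def div_mult2_eq mult.commute[of 2 "2^k"])
  finally show ?case .
qed

lemma flips_eq_digit_plus_sum_flips:
  assumes "1 \<le> k" "k \<le> r" "m < 2 ^ r"
  shows "flips k m = digit k m + (\<Sum>l=k+1..r. flips l m)"
  using flips_eq_digit[OF assms(1)] sum_flips_above[OF assms(2,3)] by simp

lemma sum_digits_above:
  assumes "k \<le> r" "m < 2 ^ r"
  shows "(\<Sum>l=k+1..r. 2 ^ (l - k - 1) * digit l m) = m div 2 ^ k"
  using assms(1)
proof (induction rule: inc_induct)
  case base
  then show ?case using assms by simp
next
  case (step k)
  have "(\<Sum>l=k+1..r. 2 ^ (l - k - 1) * digit l m)
      = digit (k + 1) m + (\<Sum>l=Suc k+1..r. 2 ^ (l - k - 1) * digit l m)"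
    using step by (simp add: sum.atLeast_Suc_atMost)
  also have "(\<Sum>l=Suc k+1..r. 2 ^ (l - k - 1) * digit l m)
      = 2 * (\<Sum>l=Suc k+1..r. 2 ^ (l - Suc k - 1) * digit l m)"
    unfolding sum_distrib_left
  proof (intro sum.cong refl)
    fix l assume "l \<in> {Suc k+1..r}"
    then have "l - k - 1 = Suc (l - Suc k - 1)" by auto
    then show "2 ^ (l - k - 1) * digit l m = 2 * (2 ^ (l - Suc k - 1) * digit l m)" by simp
  qed
  also have "digit (k + 1) m + \<dots> = m div 2 ^ k"
    unfolding step.IH by (simp add: digit_def div_mult2_eq mult.commute[of 2 "2^k"])
  finally show ?case .
qed

lemma digits_determine:
  assumes "m < 2 ^ r" "n < 2 ^ r" and "\<And>k. k \<in> {1..r} \<Longrightarrow> digit k m = digit k n"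
  shows "m = n"
proof -
  have "m = (\<Sum>l=1..r. 2 ^ (l - 1) * digit l m)"
    using sum_digits_above[of 0 r m] assms(1) by simp
  also have "\<dots> = (\<Sum>l=1..r. 2 ^ (l - 1) * digit l n)"
    using assms(3) by simp
  also have "\<dots> = n"
    using sum_digits_above[of 0 r n] assms(2) by simp
  finally show ?thesis .
qed

section \<open>Convexity of coordinate domains and the hull of the SOS2 set\<close>

lemma coord_scaleR [simp]: "coord (c *\<^sub>R x) k = c * coord x k"
proof -
  have "finite {i. c *\<^sub>R coord x i \<noteq> 0}"
    by (rule finite_subset[of _ "Poly_Mapping.keys x"]) (auto simp: in_keys_iff)
  then show ?thesis
    by (simp add: scaleR_poly_mapping_def)
qed

lemma linear_coord: "linear (\<lambda>x. coord x k)"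
  by (rule linearI) (simp_all add: lookup_add)

lemma real_vecs_iff: "x \<in> real_vecs n \<longleftrightarrow> (\<forall>k. k \<notin> {1..n} \<longrightarrow> coord x k = 0)"
  by (auto simp: real_vecs_def in_keys_iff)

lemma convex_real_vecs: "convex (real_vecs n)"
  by (auto simp: convex_def real_vecs_iff lookup_add)

lemma convex_unit_box_vecs: "convex (unit_box_vecs n)"
proof -
  have "unit_box_vecs n = real_vecs n \<inter> (\<Inter>k\<in>{1..n}. (\<lambda>x. coord x k) -` {0..1})"
    by (auto simp: unit_box_vecs_def)
  then show ?thesis
    by (auto intro!: convex_Int convex_INT convex_linear_vimage convex_real_vecs linear_coord)
qed

lemma convex_unit_simplex: "convex (unit_simplex n)"
proof -
  have "unit_simplex n = real_vecs n \<inter> (\<Inter>v\<in>{1..n}. (\<lambda>x. coord x v) -` {0..})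
      \<inter> (\<lambda>x. \<Sum>v=1..n. coord x v) -` {1}"
    by (auto simp: unit_simplex_def)
  then show ?thesis
    by (auto intro!: convex_Int convex_INT convex_linear_vimage convex_real_vecs linear_coord
        linear_compose_sum)
qed

definition rvec_of :: "nat \<Rightarrow> (nat \<Rightarrow> real) \<Rightarrow> rvec" where
  "rvec_of n f = Abs_poly_mapping (\<lambda>k. if k \<in> {1..n} then f k else 0)"

lemma coord_rvec_of [simp]: "coord (rvec_of n f) k = (if k \<in> {1..n} then f k else 0)"
proof -
  have "finite {k. (if k \<in> {1..n} then f k else 0) \<noteq> 0}"
    by (rule finite_subset[of _ "{1..n}"]) auto
  then show ?thesis
    by (simp add: rvec_of_def)
qed

lemma rvec_of_in_real_vecs: "rvec_of n f \<in> real_vecs n"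
  by (simp add: real_vecs_iff)

abbreviation unit_vec :: "nat \<Rightarrow> rvec" where
  "unit_vec v \<equiv> Poly_Mapping.single v 1"

lemma coord_unit_vec: "coord (unit_vec v) w = (if v = w then 1 else 0)"
  by (simp add: lookup_single when_def)

lemma unit_vec_in_unit_simplex: "v \<in> {1..n} \<Longrightarrow> unit_vec v \<in> unit_simplex n"
  by (auto simp: unit_simplex_def real_vecs_iff coord_unit_vec)

lemma unit_simplex_eq_sum_unit_vecs:
  assumes "x \<in> unit_simplex n"
  shows "x = (\<Sum>v=1..n. coord x v *\<^sub>R unit_vec v)"
proof (rule poly_mapping_eqI)
  fix w
  show "coord x w = coord (\<Sum>v=1..n. coord x v *\<^sub>R unit_vec v) w"
    using assms by (auto simp: lookup_sum coord_unit_vec if_distrib unit_simplex_def real_vecs_iff cong: if_cong)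
qed

lemma convex_hull_sos2: "convex hull (sos2 d) = unit_simplex (d + 1)" if "d \<ge> 1"
proof
  show "convex hull (sos2 d) \<subseteq> unit_simplex (d + 1)"
    by (rule hull_minimal) (auto simp: sos2_def simplex_face_def convex_unit_simplex)
next
  have *: "unit_vec v \<in> sos2 d" if v: "v \<in> {1..d+1}" for v
  proof (cases "v = d + 1")
    case True
    then show ?thesis
      using \<open>d \<ge> 1\<close> unit_vec_in_unit_simplex[OF v]
      by (auto simp: sos2_def simplex_face_def coord_unit_vec intro!: bexI[of _ d])
  next
    case False
    then show ?thesis
      using v unit_vec_in_unit_simplex[OF v]
      by (auto simp: sos2_def simplex_face_def coord_unit_vec intro!: bexI[of _ v])
  qed
  show "unit_simplex (d + 1) \<subseteq> convex hull (sos2 d)"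
  proof
    fix x assume x: "x \<in> unit_simplex (d + 1)"
    have "(\<Sum>v=1..d+1. coord x v *\<^sub>R unit_vec v) \<in> convex hull (sos2 d)"
      using x by (intro convex_sum hull_inc *) (auto simp: unit_simplex_def)
    then show "x \<in> convex hull (sos2 d)"
      using unit_simplex_eq_sum_unit_vecs[OF x] by simp
  qed
qed

section \<open>The LP relaxation as a convex hull\<close>

definition lower_row :: "nat \<Rightarrow> nat \<Rightarrow> rvec \<Rightarrow> real" where
  "lower_row r k x = (\<Sum>v=1..2 ^ r + 1. real_of_int (zigzag_ext r (v - 1) k) * coord x v)"

definition upper_row :: "nat \<Rightarrow> nat \<Rightarrow> rvec \<Rightarrow> real" where
  "upper_row r k x = (\<Sum>v=1..2 ^ r + 1. real_of_int (zigzag_ext r v k) * coord x v)"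

lemma linear_lower_row: "linear (lower_row r k)"
  unfolding lower_row_def
  by (intro linear_compose_sum ballI linear_coord linear_compose_scale_right[where 'b = real, simplified])

lemma linear_upper_row: "linear (upper_row r k)"
  unfolding upper_row_def
  by (intro linear_compose_sum ballI linear_coord linear_compose_scale_right[where 'b = real, simplified])

lemma lower_row_eq_flips:
  assumes "k \<in> {1..r}"
  shows "lower_row r k x = (\<Sum>v=1..2 ^ r + 1. flips k (v - 2) * coord x v)"
  unfolding lower_row_def
proof (rule sum.cong[OF refl])
  fix v :: nat assume v: "v \<in> {1..2 ^ r + 1}"
  then have "min (v - 1 - 1) (2 ^ r - 1) = v - 2" by auto
  then show "real_of_int (zigzag_ext r (v - 1) k) * coord x v = flips k (v - 2) * coord x v"
    using zigzag_ext_eq_flips[of k r "v - 1"] assms v by simp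
qed

lemma upper_row_eq_flips:
  assumes "k \<in> {1..r}"
  shows "upper_row r k x = (\<Sum>v=1..2 ^ r + 1. flips k (min (v - 1) (2 ^ r - 1)) * coord x v)"
  unfolding upper_row_def using zigzag_ext_eq_flips[of k r] assms by (intro sum.cong) auto

text \<open>
  The common form of the two systems. \<open>F k y\<close> is the expression in \<open>y\<close> that the \<open>k\<close>-th pair of
  inequalities bounds, \<open>Y\<close> is the domain of \<open>y\<close> in the LP relaxation, and \<open>code j\<close> is the value of \<open>y\<close>
  that selects the segment between the vertices \<open>j + 1\<close> and \<open>j + 2\<close>. Injectivity of \<open>F\<close> is what allows a
  convex combination of codes to be recognised as a given \<open>y\<close> by comparing the bounded expressions.
\<close>

locale zigzag_encoding =
  fixes r :: nat and F :: "nat \<Rightarrow> rvec \<Rightarrow> real" and Y :: "rvec set" and code :: "nat \<Rightarrow> rvec"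
  assumes linear_F: "linear (F k)"
    and F_inject: "\<lbrakk>y \<in> real_vecs r; \<And>k. k \<in> {1..r} \<Longrightarrow> F k y = 0\<rbrakk> \<Longrightarrow> y = 0"
    and convex_Y: "convex Y" and Y_real: "Y \<subseteq> real_vecs r"
    and code_Y: "j < 2 ^ r \<Longrightarrow> code j \<in> Y"
    and F_code: "\<lbrakk>j < 2 ^ r; k \<in> {1..r}\<rbrakk> \<Longrightarrow> F k (code j) = real (flips k j)"
begin

definition system :: "rvec set \<Rightarrow> (rvec \<times> rvec) set" where
  "system Y' = {(x, y). x \<in> unit_simplex (2 ^ r + 1) \<and> y \<in> Y' \<and>
     (\<forall>k\<in>{1..r}. lower_row r k x \<le> F k y \<and> F k y \<le> upper_row r k x)}"

definition vertices :: "(rvec \<times> rvec) set" where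
  "vertices = (\<Union>j<2 ^ r. {unit_vec (j + 1), unit_vec (j + 2)} \<times> {code j})"

lemma vertexI: "\<lbrakk>j < 2 ^ r; v = j + 1 \<or> v = j + 2\<rbrakk> \<Longrightarrow> (unit_vec v, code j) \<in> vertices"
  by (auto simp: vertices_def)

lemma linear_rows:
  "linear (\<lambda>p. F k (snd p) - lower_row r k (fst p))"
  "linear (\<lambda>p. upper_row r k (fst p) - F k (snd p))"
  using linear_compose[OF linear_fst linear_lower_row] linear_compose[OF linear_fst linear_upper_row]
    linear_compose[OF linear_snd linear_F]
  by (auto intro!: linear_compose_sub simp: o_def)

lemma convex_system: "convex (system Y)"
proof -
  have "system Y = unit_simplex (2 ^ r + 1) \<times> Y \<inter>
     (\<Inter>k\<in>{1..r}. (\<lambda>p. F k (snd p) - lower_row r k (fst p)) -` {0..} \<inter>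
       (\<lambda>p. upper_row r k (fst p) - F k (snd p)) -` {0..})"
    by (auto simp: system_def)
  then show ?thesis
    by (auto intro!: convex_Int convex_INT convex_Times convex_linear_vimage convex_unit_simplex
        convex_Y linear_rows)
qed

text \<open>
  Monotonicity of the codes: vertex \<open>j + 1\<close> has lower row \<open>C\<^sub>j\<^sub>-\<^sub>1\<close> and upper row \<open>C\<^sub>j\<close>, vertex \<open>j + 2\<close>
  has lower row \<open>C\<^sub>j\<close> and upper row \<open>C\<^sub>j\<^sub>+\<^sub>1\<close>, with indices clamped to \<open>{0..2 ^ r - 1}\<close>. So \<open>C\<^sub>j\<close> lies
  between the bounds for both.
\<close>

lemma segment_in_system:
  assumes x: "x \<in> simplex_face (2 ^ r + 1) {j + 1, j + 2}" and j: "j < 2 ^ r"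
    and y: "code j \<in> Y'"
  shows "(x, code j) \<in> system Y'"
proof -
  have S: "x \<in> unit_simplex (2 ^ r + 1)" and x0: "\<And>v. v \<in> {1..2 ^ r + 1} - {j + 1, j + 2} \<Longrightarrow> coord x v = 0"
    using x by (auto simp: simplex_face_def)
  have x1: "coord x v \<ge> 0" if "v \<in> {1..2 ^ r + 1}" for v
    using S that by (auto simp: unit_simplex_def)
  have sum1: "(\<Sum>v=1..2 ^ r + 1. coord x v) = 1"
    using S by (simp add: unit_simplex_def)
  have "lower_row r k x \<le> flips k j \<and> flips k j \<le> upper_row r k x" if k: "k \<in> {1..r}" for k
  proof
    have le: "flips k (v - 2) * coord x v \<le> flips k j * coord x v \<and>
       flips k j * coord x v \<le> flips k (min (v - 1) (2 ^ r - 1)) * coord x v"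
      if v: "v \<in> {1..2 ^ r + 1}" for v
    proof (cases "v \<in> {j + 1, j + 2}")
      case True
      then show ?thesis
        using j x1[OF v] by (auto intro!: mult_right_mono flips_mono)
    qed (use x0 v in auto)
    have sum_eq: "(\<Sum>v=1..2 ^ r + 1. flips k j * coord x v) = real (flips k j)"
      using sum1 by (simp only: sum_distrib_left[symmetric] mult_1_right)
    have "lower_row r k x \<le> (\<Sum>v=1..2 ^ r + 1. flips k j * coord x v)"
      unfolding lower_row_eq_flips[OF k] by (rule sum_mono) (use le in blast)
    then show "lower_row r k x \<le> flips k j"
      unfolding sum_eq .
    have "(\<Sum>v=1..2 ^ r + 1. flips k j * coord x v) \<le> upper_row r k x"
      unfolding upper_row_eq_flips[OF k] by (rule sum_mono) (use le in blast)
    then show "flips k j \<le> upper_row r k x"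
      unfolding sum_eq .
  qed
  then show ?thesis
    using S y j by (auto simp: system_def F_code)
qed

lemma vertices_subset_system: "vertices \<subseteq> system Y"
proof -
  have "unit_vec v \<in> simplex_face (2 ^ r + 1) {j + 1, j + 2}" if "v = j + 1 \<or> v = j + 2" "j < 2 ^ r" for v j
    using that unit_vec_in_unit_simplex[of v "2 ^ r + 1"]
    by (auto simp: simplex_face_def coord_unit_vec)
  then show ?thesis
    by (auto simp: vertices_def intro!: segment_in_system code_Y)
qed

lemma F_eqI:
  assumes "y \<in> real_vecs r" "z \<in> real_vecs r" "\<And>k. k \<in> {1..r} \<Longrightarrow> F k y = F k z"
  shows "y = z"
proof -
  have "y - z \<in> real_vecs r"
    using assms(1,2) by (simp add: real_vecs_iff lookup_minus)
  then show ?thesis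
    using F_inject[of "y - z"] assms(3) by (simp add: linear_diff[OF linear_F])
qed

text \<open>
  Every column \<open>k\<close> prescribes a fraction \<open>t k\<close> between its two bounds. Over a
  vertex \<open>v\<close> the bounds differ in at most one column, so a single fraction \<open>\<tau> v\<close> on the segment
  between the two codes of \<open>v\<close> can realise the prescribed fractions of all columns at once.
\<close>

lemma system_subset_hull: "system Y \<subseteq> convex hull vertices"
proof clarify
  fix x y assume xy: "(x, y) \<in> system Y"
  then have x: "x \<in> unit_simplex (2 ^ r + 1)" and y: "y \<in> Y"
    and bounds: "\<And>k. k \<in> {1..r} \<Longrightarrow> lower_row r k x \<le> F k y \<and> F k y \<le> upper_row r k x"
    by (auto simp: system_def)
  let ?V = "{1..2 ^ r + 1} :: nat set"
  \<comment> \<open>The two codes at vertex \<open>v\<close> are \<open>v - 2\<close> and \<open>hi v\<close>, equal at the end vertices.\<close>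
  define hi :: "nat \<Rightarrow> nat" where "hi v = min (v - 1) (2 ^ r - 1)" for v
  have "\<exists>t. 0 \<le> t \<and> t \<le> 1 \<and> F k y = (1 - t) * lower_row r k x + t * upper_row r k x"
    if "k \<in> {1..r}" for k
  proof -
    have "F k y \<in> closed_segment (lower_row r k x) (upper_row r k x)"
      using bounds[OF that] by (simp add: closed_segment_eq_real_ivl)
    then show ?thesis
      by (auto simp: closed_segment_def)
  qed
  then obtain t where t: "0 \<le> t k \<and> t k \<le> 1 \<and>
      F k y = (1 - t k) * lower_row r k x + t k * upper_row r k x" if "k \<in> {1..r}" for k
    by metis
  \<comment> \<open>Where no column jumps, the two codes at \<open>v\<close> coincide in all columns and any fraction does.\<close>
  have "\<exists>\<tau>. 0 \<le> \<tau> \<and> \<tau> \<le> 1 \<and> (\<forall>k\<in>{1..r}. flips k (hi v) \<noteq> flips k (v - 2) \<longrightarrow> \<tau> = t k)"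
    if v: "v \<in> ?V" for v
  proof (cases "\<exists>k\<in>{1..r}. flips k (hi v) \<noteq> flips k (v - 2)")
    case True
    then obtain k where k: "k \<in> {1..r}" "flips k (hi v) \<noteq> flips k (v - 2)" by blast
    then have hi: "hi v = Suc (v - 2)"
      using v by (cases "v = 1"; cases "v = 2 ^ r + 1") (auto simp: hi_def)
    have "t l = t k" if "l \<in> {1..r}" "flips l (hi v) \<noteq> flips l (v - 2)" for l
      using flips_jump_unique[of k "v - 2" l] k that hi by simp
    then show ?thesis
      using t[OF k(1)] by (intro exI[of _ "t k"]) auto
  next
    case False
    then show ?thesis by (intro exI[of _ 0]) auto
  qed
  then obtain \<tau> where \<tau>: "0 \<le> \<tau> v \<and> \<tau> v \<le> 1 \<and>
      (\<forall>k\<in>{1..r}. flips k (hi v) \<noteq> flips k (v - 2) \<longrightarrow> \<tau> v = t k)" if "v \<in> ?V" for v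
    by metis
  define w where "w v = (1 - \<tau> v) *\<^sub>R code (v - 2) + \<tau> v *\<^sub>R code (hi v)" for v
  have lt: "v - 2 < 2 ^ r" "hi v < 2 ^ r" if "v \<in> ?V" for v
  proof -
    have "(0::nat) < 2 ^ r" by simp
    then show "v - 2 < 2 ^ r" "hi v < 2 ^ r"
      using that unfolding hi_def atLeastAtMost_iff by linarith+
  qed
  have w_hull: "(unit_vec v, w v) \<in> convex hull vertices" if v: "v \<in> ?V" for v
  proof -
    have "v = v - 2 + 1 \<or> v = v - 2 + 2" "v = hi v + 1 \<or> v = hi v + 2"
      using v unfolding hi_def atLeastAtMost_iff by linarith+
    then have "(unit_vec v, code (v - 2)) \<in> vertices" "(unit_vec v, code (hi v)) \<in> vertices"
      using lt[OF v] by (auto intro!: vertexI simp only:)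
    then have "(1 - \<tau> v) *\<^sub>R (unit_vec v, code (v - 2)) + \<tau> v *\<^sub>R (unit_vec v, code (hi v))
        \<in> convex hull vertices"
      using \<tau>[OF v] by (intro convexD[OF convex_convex_hull] hull_inc) auto
    moreover have "(1 - \<tau> v) *\<^sub>R (unit_vec v, code (v - 2)) + \<tau> v *\<^sub>R (unit_vec v, code (hi v))
        = (unit_vec v, w v)"
      unfolding w_def by (rule prod_eqI) (simp_all flip: scaleR_add_left)
    ultimately show ?thesis
      by (simp only:)
  qed
  have "(\<Sum>v\<in>?V. coord x v *\<^sub>R (unit_vec v, w v)) \<in> convex hull vertices"
    using x w_hull by (intro convex_sum convex_convex_hull) (auto simp: unit_simplex_def)
  moreover have "(\<Sum>v\<in>?V. coord x v *\<^sub>R (unit_vec v, w v)) = (x, y)"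
  proof (rule prod_eqI)
    show "fst (\<Sum>v\<in>?V. coord x v *\<^sub>R (unit_vec v, w v)) = fst (x, y)"
      using unit_simplex_eq_sum_unit_vecs[OF x] by (simp add: fst_sum del: sum.cl_ivl_Suc)
    have "(\<Sum>v\<in>?V. coord x v *\<^sub>R w v) = y"
    proof (rule F_eqI)
      show "(\<Sum>v\<in>?V. coord x v *\<^sub>R w v) \<in> real_vecs r"
      proof (rule convex_sum[OF _ convex_real_vecs])
        show "w v \<in> real_vecs r" if "v \<in> ?V" for v
          unfolding w_def using lt[OF that] code_Y Y_real \<tau>[OF that]
          by (intro convexD[OF convex_real_vecs]) auto
      qed (use x in \<open>auto simp: unit_simplex_def\<close>)
      show "y \<in> real_vecs r" using y Y_real by auto
      fix k assume k: "k \<in> {1..r}"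
      have "F k (\<Sum>v\<in>?V. coord x v *\<^sub>R w v) = (\<Sum>v\<in>?V. coord x v * F k (w v))"
        by (simp add: linear_sum[OF linear_F] linear_scale[OF linear_F] del: sum.cl_ivl_Suc)
      also have "\<dots> = (\<Sum>v\<in>?V. (1 - t k) * (flips k (v - 2) * coord x v) + t k * (flips k (hi v) * coord x v))"
      proof (rule sum.cong[OF refl])
        fix v assume v: "v \<in> ?V"
        have "F k (w v) = (1 - \<tau> v) * flips k (v - 2) + \<tau> v * flips k (hi v)"
          using lt[OF v] k
          by (simp add: w_def linear_add[OF linear_F] linear_scale[OF linear_F] F_code)
        also have "\<dots> = (1 - t k) * flips k (v - 2) + t k * flips k (hi v)"
          using \<tau>[OF v] k by (cases "flips k (hi v) = flips k (v - 2)") (auto simp: algebra_simps)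
        finally have Fw: "F k (w v) = \<dots>" .
        show "coord x v * F k (w v)
            = (1 - t k) * (flips k (v - 2) * coord x v) + t k * (flips k (hi v) * coord x v)"
          unfolding Fw by (simp add: algebra_simps)
      qed
      also have "\<dots> = (1 - t k) * lower_row r k x + t k * upper_row r k x"
        unfolding lower_row_eq_flips[OF k] upper_row_eq_flips[OF k] hi_def
        by (subst sum.distrib) (simp only: sum_distrib_left)
      also have "\<dots> = F k y" using t[OF k] by simp
      finally show "F k (\<Sum>v\<in>?V. coord x v *\<^sub>R w v) = F k y" .
    qed
    then show "snd (\<Sum>v\<in>?V. coord x v *\<^sub>R (unit_vec v, w v)) = snd (x, y)"
      by (simp add: snd_sum del: sum.cl_ivl_Suc)
  qed
  ultimately show "(x, y) \<in> convex hull vertices" by simp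
qed

lemma system_eq_hull: "system Y = convex hull vertices"
  using system_subset_hull hull_minimal[of vertices "system Y" convex] vertices_subset_system
    convex_system by blast

lemma extreme_point_is_code:
  assumes "(x, y) extreme_point_of system Y"
  shows "y \<in> code ` {..<2 ^ r}"
  using extreme_point_of_convex_hull[of "(x, y)" vertices] assms
  by (auto simp: system_eq_hull vertices_def)

lemma sos2_imp_system:
  assumes "x \<in> sos2 (2 ^ r)" and "\<And>j. j < 2 ^ r \<Longrightarrow> code j \<in> Y'"
  shows "\<exists>y. (x, y) \<in> system Y'"
proof -
  obtain i where i: "i \<in> {1..2 ^ r}" "x \<in> simplex_face (2 ^ r + 1) {i, i + 1}"
    using assms(1) by (auto simp: sos2_def)
  then have "(x, code (i - 1)) \<in> system Y'"
    by (intro segment_in_system assms(2)) auto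
  then show ?thesis ..
qed

lemma projection_system: "fst ` system Y = convex hull sos2 (2 ^ r)"
proof
  show "fst ` system Y \<subseteq> convex hull sos2 (2 ^ r)"
    by (auto simp: convex_hull_sos2 system_def)
  have "convex (fst ` system Y)"
    by (intro convex_linear_image linear_fst convex_system)
  moreover have "sos2 (2 ^ r) \<subseteq> fst ` system Y"
  proof
    fix x assume "x \<in> sos2 (2 ^ r)"
    then obtain y where "(x, y) \<in> system Y"
      using sos2_imp_system code_Y by blast
    then show "x \<in> fst ` system Y" by force
  qed
  ultimately show "convex hull sos2 (2 ^ r) \<subseteq> fst ` system Y"
    by (simp add: hull_minimal)
qed

lemma ideal_system:
  assumes "\<And>j. j < 2 ^ r \<Longrightarrow> code j \<in> Z \<and> code j \<in> int_vecs r"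
    and "\<And>x y. (x, y) \<in> system Z \<Longrightarrow> x \<in> sos2 (2 ^ r)"
  shows "ideal_formulation r (system Z) (system Y) (sos2 (2 ^ r))"
  unfolding ideal_formulation_def is_formulation_def
proof (intro conjI allI impI iffI)
  show "\<exists>y. (x, y) \<in> system Z" if "x \<in> sos2 (2 ^ r)" for x
    using that assms(1) by (simp add: sos2_imp_system)
  show "x \<in> sos2 (2 ^ r)" if "\<exists>y. (x, y) \<in> system Z" for x
    using that assms(2) by blast
  show "y \<in> int_vecs r" if "(x, y) extreme_point_of system Y" for x y
    using extreme_point_is_code[OF that] assms(1) by auto
qed (rule projection_system)

end

section \<open>Integer points of the relaxation\<close>

definition zigzag_code :: "nat \<Rightarrow> nat \<Rightarrow> rvec" where
  "zigzag_code r j = rvec_of r (\<lambda>k. flips k j)"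

interpretation integer: zigzag_encoding r "\<lambda>k y. coord y k" "real_vecs r" "zigzag_code r" for r
proof (rule zigzag_encoding.intro)
  show "y = 0" if "y \<in> real_vecs r" "\<And>k. k \<in> {1..r} \<Longrightarrow> coord y k = 0" for y
    using that by (intro poly_mapping_eqI) (auto simp: real_vecs_iff)
qed (auto simp: linear_coord convex_real_vecs zigzag_code_def rvec_of_in_real_vecs)

lemma zigzag_integer_system_eq: "zigzag_integer_system r Z = integer.system r Z"
  by (simp add: zigzag_integer_system_def integer.system_def lower_row_def upper_row_def)

text \<open>
  The linear map that recovers binary digits from zigzag codes; it inverts the map \<open>twist\<close> below.
\<close>

definition untwist :: "nat \<Rightarrow> nat \<Rightarrow> rvec \<Rightarrow> real" where
  "untwist r k y = coord y k - (\<Sum>l=k+1..r. coord y l)"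

lemma linear_untwist: "linear (untwist r k)"
  unfolding untwist_def by (intro linear_compose_sub linear_compose_sum ballI linear_coord)

lemma untwist_zigzag_code:
  assumes "k \<in> {1..r}" "j < 2 ^ r"
  shows "untwist r k (zigzag_code r j) = digit k j"
proof -
  have "(\<Sum>l=k+1..r. coord (zigzag_code r j) l) = real (\<Sum>l=k+1..r. flips l j)"
    unfolding of_nat_sum zigzag_code_def by (rule sum.cong) auto
  then show ?thesis
    using flips_eq_digit_plus_sum_flips[of k r j] assms by (simp add: untwist_def zigzag_code_def)
qed

text \<open>
  The digits of all codes lie in \<open>{0, 1}\<close>, so on the convex hull they lie in the interval \<open>{0..1}\<close>,
  where an integer is 0 or 1.
\<close>

lemma untwist_binary:
  assumes xy: "(x, y) \<in> integer.system r (real_vecs r)" and y: "y \<in> int_vecs r" and k: "k \<in> {1..r}"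
  shows "untwist r k y = 0 \<or> untwist r k y = 1"
proof -
  have "linear (\<lambda>p :: rvec \<times> rvec. untwist r k (snd p))"
    using linear_compose[OF linear_snd linear_untwist] by (simp add: o_def)
  then have "convex ((\<lambda>p :: rvec \<times> rvec. untwist r k (snd p)) -` {0..1})"
    by (rule convex_linear_vimage) simp
  moreover have "integer.vertices r \<subseteq> (\<lambda>p. untwist r k (snd p)) -` {0..1}"
    using k by (auto simp: integer.vertices_def untwist_zigzag_code digit_def)
  ultimately have "(x, y) \<in> (\<lambda>p. untwist r k (snd p)) -` {0..1}"
    using xy hull_minimal unfolding integer.system_eq_hull by blast
  moreover have "coord y l \<in> \<int>" if "l \<in> {1..r}" for l
    using y that by (auto simp: int_vecs_def)
  then have "untwist r k y \<in> \<int>"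
    using k unfolding untwist_def by (intro Ints_diff Ints_sum) auto
  then obtain i where "untwist r k y = of_int i" by (elim Ints_cases)
  ultimately show ?thesis by auto
qed

text \<open>
  For a binary vector \<open>z\<close>, the distance \<open>\<Sum>\<^sub>k \<bar>z\<^sub>k - \<zeta>\<^sub>k\<bar> = \<Sum>\<^sub>k (z\<^sub>k + (1 - 2 z\<^sub>k) \<zeta>\<^sub>k)\<close> is affine in
  \<open>\<zeta> \<in> {0..1}\<^sup>r\<close>. If no code available at \<open>v\<close> has the digits \<open>z\<close>, then \<open>x\<^sub>v\<close> is bounded by this distance
  at every vertex of the LP relaxation, and so on all of it. At the given point, whose digits are \<open>z\<close>,
  the distance is 0, contradicting \<open>x\<^sub>v > 0\<close>.
\<close>

lemma support_of_integer_point: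
  assumes xy: "(x, y) \<in> integer.system r (real_vecs r)" and y: "y \<in> int_vecs r"
    and v: "coord x v > 0"
  shows "\<exists>j<2 ^ r. (v = j + 1 \<or> v = j + 2) \<and> (\<forall>k\<in>{1..r}. digit k j = untwist r k y)"
proof (rule ccontr)
  assume none: "\<not> ?thesis"
  define z where "z k = untwist r k y" for k
  have z: "z k = 0 \<or> z k = 1" if "k \<in> {1..r}" for k
    unfolding z_def using untwist_binary[OF xy y that] .
  \<comment> \<open>The coordinate \<open>x\<^sub>v\<close> minus the linear part of the distance; the constant part is \<open>\<Sum>\<^sub>k z k\<close>.\<close>
  define g where
    "g p = coord (fst p) v - (\<Sum>k=1..r. (1 - 2 * z k) * untwist r k (snd p))" for p :: "rvec \<times> rvec"
  have "linear (\<lambda>p :: rvec \<times> rvec. coord (fst p) v)"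
    using linear_compose[OF linear_fst linear_coord] by (simp add: o_def)
  moreover have "linear (\<lambda>p :: rvec \<times> rvec. untwist r k (snd p))" for k
    using linear_compose[OF linear_snd linear_untwist] by (simp add: o_def)
  ultimately have "linear g"
    unfolding g_def
    by (intro linear_compose_sub linear_compose_sum ballI
        linear_compose_scale_right[where 'b = real, simplified])
  then have "convex (g -` {..\<Sum>k=1..r. z k})"
    by (rule convex_linear_vimage) simp
  moreover have "integer.vertices r \<subseteq> g -` {..\<Sum>k=1..r. z k}"
  proof
    fix p assume "p \<in> integer.vertices r"
    then obtain w j where p: "p = (unit_vec w, zigzag_code r j)" "j < 2 ^ r" "w = j + 1 \<or> w = j + 2"
      by (auto simp: integer.vertices_def)
    let ?dist = "\<lambda>k. z k + (1 - 2 * z k) * digit k j"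
    have nonneg: "?dist k \<ge> 0" if "k \<in> {1..r}" for k
      using z[OF that] by (auto simp: digit_def)
    have "coord (unit_vec w) v \<le> (\<Sum>k=1..r. ?dist k)"
    proof (cases "v = w")
      case True
      then obtain k where k: "k \<in> {1..r}" "digit k j \<noteq> z k"
        using none p by (auto simp: z_def)
      have "digit k j = 0 \<or> digit k j = 1"
        by (auto simp: digit_def)
      then have "1 \<le> ?dist k"
        using k z[OF k(1)] by auto
      also have "\<dots> \<le> (\<Sum>k=1..r. ?dist k)"
        using k nonneg by (intro member_le_sum) auto
      finally show ?thesis
        by (simp add: True)
    next
      case False
      have "0 \<le> (\<Sum>k=1..r. ?dist k)"
        by (rule sum_nonneg) (rule nonneg)
      then show ?thesis
        using False by (simp add: coord_unit_vec)
    qed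
    also have "(\<Sum>k=1..r. ?dist k)
        = (\<Sum>k=1..r. z k) + (\<Sum>k=1..r. (1 - 2 * z k) * untwist r k (zigzag_code r j))"
      using p(2) by (simp add: sum.distrib untwist_zigzag_code)
    finally show "p \<in> g -` {..\<Sum>k=1..r. z k}"
      by (simp add: g_def p(1))
  qed
  ultimately have "(x, y) \<in> g -` {..\<Sum>k=1..r. z k}"
    using xy hull_minimal unfolding integer.system_eq_hull by blast
  then have "coord x v \<le> (\<Sum>k=1..r. z k + (1 - 2 * z k) * z k)"
    by (simp add: g_def z_def sum.distrib)
  also have "\<dots> = 0"
    using z by (intro sum.neutral) fastforce
  finally show False
    using v by simp
qed

text \<open>
  Every coordinate in the support of \<open>x\<close> admits a code whose digits are those of \<open>y\<close>. As digits
  determine the number, one \<open>j\<close> serves for the whole support.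
\<close>

lemma integer_point_imp_sos2:
  assumes "(x, y) \<in> integer.system r (int_vecs r)"
  shows "x \<in> sos2 (2 ^ r)"
proof -
  have y: "y \<in> int_vecs r" and xy: "(x, y) \<in> integer.system r (real_vecs r)"
    using assms by (auto simp: integer.system_def int_vecs_def)
  have x: "x \<in> unit_simplex (2 ^ r + 1)"
    using assms by (simp add: integer.system_def)
  have "\<exists>v\<in>{1..2 ^ r + 1}. coord x v \<noteq> 0"
    using x sum.neutral[of "{1..2 ^ r + 1}" "coord x"] unfolding unit_simplex_def mem_Collect_eq
    by (metis zero_neq_one)
  then obtain v where v: "v \<in> {1..2 ^ r + 1}" "coord x v > 0"
    using x by (force simp: unit_simplex_def)
  obtain j where j: "j < 2 ^ r" "\<forall>k\<in>{1..r}. digit k j = untwist r k y"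
    using support_of_integer_point[OF xy y v(2)] by (elim exE conjE) (rule that)
  have "coord x w = 0" if w: "w \<in> {1..2 ^ r + 1} - {j + 1, j + 2}" for w
  proof (rule ccontr)
    assume "coord x w \<noteq> 0"
    moreover have "coord x w \<ge> 0"
      using x w unfolding unit_simplex_def by blast
    ultimately have w_pos: "coord x w > 0" by linarith
    obtain i where i: "i < 2 ^ r" "w = i + 1 \<or> w = i + 2" "\<forall>k\<in>{1..r}. digit k i = untwist r k y"
      using support_of_integer_point[OF xy y w_pos] by (elim exE conjE) (rule that)
    have "i = j"
    proof (rule digits_determine[OF i(1) j(1)])
      show "digit k i = digit k j" if "k \<in> {1..r}" for k
        using that i(3) j(2) by (metis of_nat_eq_iff)
    qed
    then show False
      using i(2) w by auto
  qed
  then have "x \<in> simplex_face (2 ^ r + 1) {j + 1, j + 1 + 1}"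
    using x by (auto simp: simplex_face_def)
  then show ?thesis
    using j(1) unfolding sos2_def by (intro UN_I[of "j + 1"]) auto
qed

section \<open>The binary substitution\<close>

definition twist :: "nat \<Rightarrow> nat \<Rightarrow> rvec \<Rightarrow> real" where
  "twist r k y = coord y k + (\<Sum>l=k+1..r. 2 ^ (l - k - 1) * coord y l)"

definition digit_code :: "nat \<Rightarrow> nat \<Rightarrow> rvec" where
  "digit_code r j = rvec_of r (\<lambda>k. digit k j)"

lemma digit_code_binary: "digit_code r j \<in> binary_vecs r"
  by (auto simp: binary_vecs_def digit_code_def rvec_of_in_real_vecs digit_def)

lemma binary_subset:
  "binary_vecs r \<subseteq> unit_box_vecs r" "binary_vecs r \<subseteq> int_vecs r"
  by (auto simp: binary_vecs_def unit_box_vecs_def int_vecs_def)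

interpretation binary: zigzag_encoding r "twist r" "unit_box_vecs r" "digit_code r" for r
proof (rule zigzag_encoding.intro)
  show "linear (twist r k)" for k
    unfolding twist_def
    by (intro linear_compose_add linear_compose_sum ballI linear_coord
        linear_compose_scale_right[where 'b = real, simplified])
  show "y = 0" if y: "y \<in> real_vecs r" "\<And>k. k \<in> {1..r} \<Longrightarrow> twist r k y = 0" for y
  proof (rule poly_mapping_eqI)
    fix k
    show "coord y k = coord 0 k"
    \<comment> \<open>Back substitution from column \<open>r\<close> downwards: the system is triangular with ones on the diagonal.\<close>
    proof (induction "r - k" arbitrary: k rule: less_induct)
      case less
      show ?case
      proof (cases "k \<in> {1..r}")
        case True
        have "coord y l = 0" if "l \<in> {k+1..r}" for l
          using less[of l] that by auto
        then show ?thesis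
          using y(2)[OF True] by (simp add: twist_def)
      qed (use y(1) in \<open>simp add: real_vecs_iff\<close>)
    qed
  qed
  show "unit_box_vecs r \<subseteq> real_vecs r"
    by (auto simp: unit_box_vecs_def)
  show "digit_code r j \<in> unit_box_vecs r" for j
    using digit_code_binary binary_subset by blast
  show "twist r k (digit_code r j) = flips k j" if "j < 2 ^ r" "k \<in> {1..r}" for j k
  proof -
    have "(\<Sum>l=k+1..r. 2 ^ (l - k - 1) * coord (digit_code r j) l)
        = real (\<Sum>l=k+1..r. 2 ^ (l - k - 1) * digit l j)"
      unfolding of_nat_sum digit_code_def by (rule sum.cong) auto
    also have "\<dots> = real (j div 2 ^ k)"
      using sum_digits_above[of k r j] that by simp
    finally show ?thesis
      using that by (simp add: twist_def flips_eq_digit digit_code_def)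
  qed
qed (rule convex_unit_box_vecs)

lemma zigzag_binary_system_eq: "zigzag_binary_system r Z = binary.system r Z"
  by (simp add: zigzag_binary_system_def binary.system_def lower_row_def upper_row_def twist_def)

text \<open>
  The substitution has integer coefficients, so it carries a solution of the second
  system to an integer solution of the first with the same \<open>x\<close>.
\<close>

lemma binary_point_imp_sos2:
  assumes xy: "(x, y) \<in> binary.system r (binary_vecs r)"
  shows "x \<in> sos2 (2 ^ r)"
proof (rule integer_point_imp_sos2)
  have "y \<in> int_vecs r"
    using xy binary_subset(2) by (auto simp: binary.system_def)
  then have y: "coord y k \<in> \<int>" if "k \<in> {1..r}" for k
    using that by (simp add: int_vecs_def)
  then have "twist r k y \<in> \<int>" if "k \<in> {1..r}" for k
    using that unfolding twist_def by (intro Ints_add Ints_sum Ints_mult Ints_power Ints_numeral y) auto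
  then show "(x, rvec_of r (\<lambda>k. twist r k y)) \<in> integer.system r (int_vecs r)"
    using xy by (auto simp: binary.system_def integer.system_def int_vecs_def rvec_of_in_real_vecs)
qed

theorem proposition3:
  fixes r d :: nat
  assumes "r \<ge> 1" and "d = 2 ^ r"
  shows "ideal_formulation r
           (zigzag_integer_system r (int_vecs r))
           (zigzag_integer_system r (real_vecs r))
           (sos2 d) \<and>
         ideal_formulation r
           (zigzag_binary_system r (binary_vecs r))
           (zigzag_binary_system r (unit_box_vecs r))
           (sos2 d)"
  unfolding zigzag_integer_system_eq zigzag_binary_system_eq \<open>d = 2 ^ r\<close>
proof
  have "zigzag_code r j \<in> int_vecs r" for j
    by (simp add: zigzag_code_def int_vecs_def rvec_of_in_real_vecs)
  then show "ideal_formulation r (integer.system r (int_vecs r)) (integer.system r (real_vecs r)) (sos2 (2 ^ r))"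
    using integer_point_imp_sos2 by (intro integer.ideal_system) auto
  have "digit_code r j \<in> int_vecs r" for j
    using digit_code_binary binary_subset(2) by blast
  then show "ideal_formulation r (binary.system r (binary_vecs r)) (binary.system r (unit_box_vecs r)) (sos2 (2 ^ r))"
    using binary_point_imp_sos2 digit_code_binary by (intro binary.ideal_system) auto
qed

end
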